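(* Let $G$ be a metagroup and let $Z_0$ be a subgroup of the center $Z(G)$ such that $t(a,b,c)\in Z_0$ for all $a,b,c\in G$. Then the quotient $G/Z_0$ is a group.
   Context: Let $G$ be a set with a single-valued binary operation $(a,b)\mapsto ab$. Consider the conditions: (i) for all $a,b\in G$ there is a unique $x\in G$ with $ax=b$, denoted $x=a\setminus b$; (ii) for all $a,b\in G$ there is a unique $y\in G$ with $ya=b$, denoted $y=b/a$; (iii) there is $e\in G$ with $eg=ge=g$ for each $g\in G$. $G$ is a loop if (i)-(iii) hold. The center of $G$ is $Z(G)=Com(G)\cap N(G)$, where $Com(G)=\{a\in G:\ ab=ba\ \forall b\in G\}$ and $N(G)$ is the set of all $a\in G$ such that $(ab)c=a(bc)$, $(ba)c=b(ac)$ and $(bc)a=b(ca)$ for all $b,c\in G$. $Z(G)$ is a commutative group. $G$ is a (nonassociative) metagroup if it is a loop and for all $a,b,c\in G$ one has $(ab)c=t(a,b,c)\,a(bc)$ with $t(a,b,c)=t_G(a,b,c)\in Z(G)$. $G/Z_0$ is the set of cosets $aZ_0=\{az: z\in Z_0\}$, $a\in G$, with the product of subsets $AB=\{ab: a\in A, b\in B\}$. *)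

theory Defs
  imports "HOL-Algebra.Left_Coset"
begin

text \<open>
  The \<open>monoid\<close> records serve only as signatures (carrier, product, unit);
  associativity is not assumed.  The unit of a loop is unique, so fixing it as the record
  field \<open>\<one>\<close> is no restriction.
\<close>

locale nonassoc_loop =
  fixes G (structure)
  assumes loop_mult_closed: "\<lbrakk>a \<in> carrier G; b \<in> carrier G\<rbrakk> \<Longrightarrow> a \<otimes> b \<in> carrier G"
    and loop_left_div: "\<lbrakk>a \<in> carrier G; b \<in> carrier G\<rbrakk> \<Longrightarrow> \<exists>!x. x \<in> carrier G \<and> a \<otimes> x = b"
    and loop_right_div: "\<lbrakk>a \<in> carrier G; b \<in> carrier G\<rbrakk> \<Longrightarrow> \<exists>!y. y \<in> carrier G \<and> y \<otimes> a = b"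
    and loop_unit_closed: "\<one> \<in> carrier G"
    and loop_unit: "g \<in> carrier G \<Longrightarrow> \<one> \<otimes> g = g \<and> g \<otimes> \<one> = g"

definition loop_Com :: "('a, 'b) monoid_scheme \<Rightarrow> 'a set" where
  "loop_Com G = {a \<in> carrier G. \<forall>b \<in> carrier G. a \<otimes>\<^bsub>G\<^esub> b = b \<otimes>\<^bsub>G\<^esub> a}"

definition loop_nucleus :: "('a, 'b) monoid_scheme \<Rightarrow> 'a set" where
  "loop_nucleus G = {a \<in> carrier G. \<forall>b \<in> carrier G. \<forall>c \<in> carrier G.
      (a \<otimes>\<^bsub>G\<^esub> b) \<otimes>\<^bsub>G\<^esub> c = a \<otimes>\<^bsub>G\<^esub> (b \<otimes>\<^bsub>G\<^esub> c) \<and>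
      (b \<otimes>\<^bsub>G\<^esub> a) \<otimes>\<^bsub>G\<^esub> c = b \<otimes>\<^bsub>G\<^esub> (a \<otimes>\<^bsub>G\<^esub> c) \<and>
      (b \<otimes>\<^bsub>G\<^esub> c) \<otimes>\<^bsub>G\<^esub> a = b \<otimes>\<^bsub>G\<^esub> (c \<otimes>\<^bsub>G\<^esub> a)}"

definition loop_center :: "('a, 'b) monoid_scheme \<Rightarrow> 'a set" where
  "loop_center G = loop_Com G \<inter> loop_nucleus G"

text \<open>
  In a loop there is exactly one \<open>t\<close> with \<open>(a \<otimes> b) \<otimes> c = t \<otimes> (a \<otimes> (b \<otimes> c))\<close>, namely the
  right quotient of \<open>(a \<otimes> b) \<otimes> c\<close> by \<open>a \<otimes> (b \<otimes> c)\<close>, so the definite description below is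
  meaningful for every loop; being a metagroup says that its values are central.
\<close>

definition loop_t :: "('a, 'b) monoid_scheme \<Rightarrow> 'a \<Rightarrow> 'a \<Rightarrow> 'a \<Rightarrow> 'a" where
  "loop_t G a b c = (THE t. t \<in> carrier G \<and>
      (a \<otimes>\<^bsub>G\<^esub> b) \<otimes>\<^bsub>G\<^esub> c = t \<otimes>\<^bsub>G\<^esub> (a \<otimes>\<^bsub>G\<^esub> (b \<otimes>\<^bsub>G\<^esub> c)))"

locale metagroup = nonassoc_loop +
  assumes metagroup_assoc:
      "\<lbrakk>a \<in> carrier G; b \<in> carrier G; c \<in> carrier G\<rbrakk> \<Longrightarrow>
        (a \<otimes> b) \<otimes> c = loop_t G a b c \<otimes> (a \<otimes> (b \<otimes> c))"
    and metagroup_t_center: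
      "\<lbrakk>a \<in> carrier G; b \<in> carrier G; c \<in> carrier G\<rbrakk> \<Longrightarrow> loop_t G a b c \<in> loop_center G"

end

theory Submission
  imports Defs
begin

text \<open>
  For a central subgroup \<open>Z\<close> the cosets multiply by \<open>aZ \<cdot> bZ = (ab)Z\<close>, since elements of \<open>Z\<close>
  commute and associate with everything, and \<open>(za)Z = aZ\<close> for \<open>z \<in> Z\<close>.  Once \<open>Z\<close> contains all
  the associators \<open>t(a,b,c)\<close>, the cosets of \<open>(ab)c\<close> and \<open>a(bc)\<close> therefore coincide.
\<close>

context nonassoc_loop
begin

lemma left_cancel:
  "\<lbrakk>a \<otimes> x = a \<otimes> y; a \<in> carrier G; x \<in> carrier G; y \<in> carrier G\<rbrakk> \<Longrightarrow> x = y"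
  by (metis loop_left_div loop_mult_closed)

lemma center_closed: "z \<in> loop_center G \<Longrightarrow> z \<in> carrier G"
  by (simp add: loop_center_def loop_Com_def)

lemma center_comm: "\<lbrakk>z \<in> loop_center G; b \<in> carrier G\<rbrakk> \<Longrightarrow> z \<otimes> b = b \<otimes> z"
  by (simp add: loop_center_def loop_Com_def)

lemma center_assoc:
  assumes "z \<in> loop_center G" "b \<in> carrier G" "c \<in> carrier G"
  shows "(z \<otimes> b) \<otimes> c = z \<otimes> (b \<otimes> c)"
    and "(b \<otimes> z) \<otimes> c = b \<otimes> (z \<otimes> c)"
    and "(b \<otimes> c) \<otimes> z = b \<otimes> (c \<otimes> z)"
  using assms by (simp_all add: loop_center_def loop_nucleus_def)

text \<open>The third nuclear identity follows from commutativity and the other two: (bc)z = z(bc) =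
  (zb)c = (bz)c = b(zc) = b(cz).\<close>

lemma centerI:
  assumes z: "z \<in> carrier G"
    and comm: "\<And>b. b \<in> carrier G \<Longrightarrow> z \<otimes> b = b \<otimes> z"
    and left: "\<And>b c. \<lbrakk>b \<in> carrier G; c \<in> carrier G\<rbrakk> \<Longrightarrow> (z \<otimes> b) \<otimes> c = z \<otimes> (b \<otimes> c)"
    and mid: "\<And>b c. \<lbrakk>b \<in> carrier G; c \<in> carrier G\<rbrakk> \<Longrightarrow> (b \<otimes> z) \<otimes> c = b \<otimes> (z \<otimes> c)"
  shows "z \<in> loop_center G"
proof -
  have "(b \<otimes> c) \<otimes> z = b \<otimes> (c \<otimes> z)" if b: "b \<in> carrier G" and c: "c \<in> carrier G" for b c
    using comm[OF b] comm[OF c] comm[OF loop_mult_closed[OF b c]] left[OF b c] mid[OF b c] by simp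
  with assms show ?thesis
    unfolding loop_center_def loop_Com_def loop_nucleus_def
    by (intro IntI CollectI conjI ballI) assumption+
qed

lemma center_mult_closed:
  assumes z: "z \<in> loop_center G" and w: "w \<in> loop_center G"
  shows "z \<otimes> w \<in> loop_center G"
proof -
  note cl = center_closed[OF z] center_closed[OF w] loop_mult_closed
  \<comment> \<open>All re-bracketing here rests on z being nuclear; w contributes its commuting
    with b.\<close>
  have "(z \<otimes> w) \<otimes> b = b \<otimes> (z \<otimes> w)" if b: "b \<in> carrier G" for b
  proof -
    have "(z \<otimes> w) \<otimes> b = z \<otimes> (b \<otimes> w)"
      using b cl by (simp add: center_assoc(1)[OF z] center_comm[OF w b])
    also have "\<dots> = (z \<otimes> b) \<otimes> w"
      using b cl by (simp add: center_assoc(1)[OF z])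
    also have "\<dots> = b \<otimes> (z \<otimes> w)"
      using b cl by (simp add: center_comm[OF z b] center_assoc(2)[OF z])
    finally show ?thesis .
  qed
  moreover have "((z \<otimes> w) \<otimes> b) \<otimes> c = (z \<otimes> w) \<otimes> (b \<otimes> c)"
    if "b \<in> carrier G" "c \<in> carrier G" for b c
    using that cl by (simp add: center_assoc(1)[OF z] center_assoc(1)[OF w])
  moreover have "(b \<otimes> (z \<otimes> w)) \<otimes> c = b \<otimes> ((z \<otimes> w) \<otimes> c)"
    if b: "b \<in> carrier G" and c: "c \<in> carrier G" for b c
  proof -
    \<comment> \<open>Splitting b(zw) as (bz)w puts w in the middle position, so its own middle
      identity applies before z is moved back.\<close>
    have "(b \<otimes> (z \<otimes> w)) \<otimes> c = ((b \<otimes> z) \<otimes> w) \<otimes> c"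
      using b cl by (simp add: center_assoc(2)[OF z])
    also have "\<dots> = (b \<otimes> z) \<otimes> (w \<otimes> c)"
      using b c cl by (simp add: center_assoc(2)[OF w])
    also have "\<dots> = b \<otimes> ((z \<otimes> w) \<otimes> c)"
      using b c cl by (simp add: center_assoc(1,2)[OF z])
    finally show ?thesis .
  qed
  ultimately show ?thesis
    using cl by (intro centerI)
qed

lemma one_center: "\<one> \<in> loop_center G"
  by (simp add: loop_center_def loop_Com_def loop_nucleus_def loop_unit_closed loop_unit
      loop_mult_closed)

text \<open>The inverse is the solution y of zy = 1. Each identity required of y is multiplied by z
  on the left: since z is central, it can be brought next to y and cancels it, so both sides become
  the same product without y, and \<open>left_cancel\<close> removes z again.\<close>

lemma center_inverse:
  assumes z: "z \<in> loop_center G"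
  obtains y where "y \<in> loop_center G" "y \<otimes> z = \<one>"
proof -
  have zc: "z \<in> carrier G" by (rule center_closed[OF z])
  obtain y where y: "y \<in> carrier G" and zy: "z \<otimes> y = \<one>"
    using ex1_implies_ex[OF loop_left_div[OF zc loop_unit_closed]] by blast
  note cl = zc y loop_mult_closed
  have zyb: "z \<otimes> (y \<otimes> b) = b" if "b \<in> carrier G" for b
    using that cl by (simp add: center_assoc(1)[OF z, symmetric] zy loop_unit)
  have comm: "y \<otimes> b = b \<otimes> y" if b: "b \<in> carrier G" for b
  proof -
    have "z \<otimes> (b \<otimes> y) = (b \<otimes> z) \<otimes> y"
      using b cl by (simp add: center_assoc(1)[OF z, symmetric] center_comm[OF z b])
    also have "\<dots> = b"
      using b cl by (simp add: center_assoc(2)[OF z] zy loop_unit)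
    finally show ?thesis
      using b cl by - (rule left_cancel[of z], simp_all add: zyb)
  qed
  have left: "(y \<otimes> b) \<otimes> c = y \<otimes> (b \<otimes> c)"
    if b: "b \<in> carrier G" and c: "c \<in> carrier G" for b c
  proof -
    have "z \<otimes> ((y \<otimes> b) \<otimes> c) = z \<otimes> (y \<otimes> (b \<otimes> c))"
      using b c cl by (simp add: center_assoc(1)[OF z, symmetric] zy loop_unit)
    then show ?thesis
      using b c cl by - (rule left_cancel[of z], simp_all)
  qed
  \<comment> \<open>This form, with y pulled out to the left, is the one that multiplication by z
    simplifies. Together with \<open>comm\<close> and \<open>left\<close> it yields the middle
    identity: (by)c = (yb)c = y(bc) = b(yc).\<close>
  have mid: "b \<otimes> (y \<otimes> c) = y \<otimes> (b \<otimes> c)"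
    if b: "b \<in> carrier G" and c: "c \<in> carrier G" for b c
  proof -
    have "z \<otimes> (b \<otimes> (y \<otimes> c)) = (b \<otimes> z) \<otimes> (y \<otimes> c)"
      using b c cl by (simp add: center_assoc(1)[OF z, symmetric] center_comm[OF z b])
    also have "\<dots> = b \<otimes> c"
      using b c cl by (simp add: center_assoc(2)[OF z] zyb)
    also have "\<dots> = z \<otimes> (y \<otimes> (b \<otimes> c))"
      using b c cl by (simp add: zyb)
    finally show ?thesis
      using b c cl by - (rule left_cancel[of z], simp_all)
  qed
  have "y \<in> loop_center G"
  proof (rule centerI[OF y comm left])
    fix b c assume b: "b \<in> carrier G" and c: "c \<in> carrier G"
    show "(b \<otimes> y) \<otimes> c = b \<otimes> (y \<otimes> c)"
      unfolding comm[OF b, symmetric] by (simp only: left[OF b c] mid[OF b c])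
  qed
  moreover have "y \<otimes> z = \<one>"
    using comm[OF zc] zy by simp
  ultimately show ?thesis by (rule that)
qed

text \<open>Since \<open>inv\<close> is a definite description, closure of a subgroup under it says
  something about actual inverses only once the center is known to be a group.\<close>

lemma group_center: "group (G\<lparr>carrier := loop_center G\<rparr>)"
proof (rule groupI)
  fix x assume "x \<in> carrier (G\<lparr>carrier := loop_center G\<rparr>)"
  then show "\<exists>y\<in>carrier (G\<lparr>carrier := loop_center G\<rparr>).
      y \<otimes>\<^bsub>G\<lparr>carrier := loop_center G\<rparr>\<^esub> x = \<one>\<^bsub>G\<lparr>carrier := loop_center G\<rparr>\<^esub>"
    using center_inverse[of x] by auto
qed (simp_all add: center_mult_closed one_center center_assoc(1) center_closed loop_unit)

context
  fixes Z
  assumes subgroup_Z: "subgroup Z (G\<lparr>carrier := loop_center G\<rparr>)"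
begin

lemma central_subgroup:
  shows central_subgroup_center: "z \<in> Z \<Longrightarrow> z \<in> loop_center G"
    and central_subgroup_mult: "\<lbrakk>z \<in> Z; w \<in> Z\<rbrakk> \<Longrightarrow> z \<otimes> w \<in> Z"
    and central_subgroup_one: "\<one> \<in> Z"
    and central_subgroup_inverse: "z \<in> Z \<Longrightarrow> \<exists>w\<in>Z. z \<otimes> w = \<one>"
proof -
  show center: "z \<in> loop_center G" if "z \<in> Z" for z
    using that subgroup.subset[OF subgroup_Z] by auto
  show "z \<otimes> w \<in> Z" if "z \<in> Z" "w \<in> Z"
    using subgroup.m_closed[OF subgroup_Z that] by simp
  show "\<one> \<in> Z"
    using subgroup.one_closed[OF subgroup_Z] by simp
  show "\<exists>w\<in>Z. z \<otimes> w = \<one>" if "z \<in> Z"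
    using subgroup.m_inv_closed[OF subgroup_Z that] group.r_inv[OF group_center, of z] center[OF that]
    by auto
qed

lemma l_coset_mult:
  assumes a: "a \<in> carrier G" and b: "b \<in> carrier G"
  shows "(a <# Z) <#> (b <# Z) = (a \<otimes> b) <# Z"
proof -
  have prod: "(a \<otimes> z) \<otimes> (b \<otimes> w) = (a \<otimes> b) \<otimes> (z \<otimes> w)" if "z \<in> Z" "w \<in> Z" for z w
  proof -
    have z: "z \<in> loop_center G" and w: "w \<in> loop_center G" and zw: "z \<otimes> w \<in> loop_center G"
      using that central_subgroup_center central_subgroup_mult by auto
    note cl = a b center_closed[OF z] center_closed[OF w] loop_mult_closed
    have "(a \<otimes> z) \<otimes> (b \<otimes> w) = a \<otimes> ((z \<otimes> b) \<otimes> w)"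
      using cl by (simp add: center_assoc(1,2)[OF z])
    \<comment> \<open>The last move, a(b(zw)) = (ab)(zw), treats zw as a single central element and
      uses its third nuclear identity.\<close>
    also have "\<dots> = (a \<otimes> b) \<otimes> (z \<otimes> w)"
      using cl by (simp add: center_comm[OF z b] center_assoc(2)[OF z] center_assoc(3)[OF zw])
    finally show ?thesis .
  qed
  \<comment> \<open>The factors are a1 and bz, with 1 and z both in \<open>Z\<close>.\<close>
  have "(a \<otimes> b) \<otimes> z \<in> (a <# Z) <#> (b <# Z)" if "z \<in> Z" for z
    using prod[OF central_subgroup_one that] that central_subgroup_one
      center_closed[OF central_subgroup_center[OF that]]
    by (force simp: l_coset_def set_mult_def loop_unit)
  moreover have "(a \<otimes> z) \<otimes> (b \<otimes> w) \<in> (a \<otimes> b) <# Z" if "z \<in> Z" "w \<in> Z" for z w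
    using central_subgroup_mult[OF that] prod[OF that] by (auto simp: l_coset_def)
  ultimately show ?thesis
    by (auto simp: l_coset_def set_mult_def)
qed

text \<open>The factor z stands on the left because this is where \<open>metagroup_assoc\<close>
  places the associator. The equation (za)w = a(zw) gives one inclusion; the other needs an inverse
  of z inside \<open>Z\<close>.\<close>

lemma l_coset_absorb:
  assumes z: "z \<in> Z" and a: "a \<in> carrier G"
  shows "(z \<otimes> a) <# Z = a <# Z"
proof -
  have zc: "z \<in> loop_center G" using z by (rule central_subgroup_center)
  have eq: "(z \<otimes> a) \<otimes> w = a \<otimes> (z \<otimes> w)" if "w \<in> Z" for w
    using center_comm[OF zc a] center_assoc(2)[OF zc a]
      center_closed[OF central_subgroup_center[OF that]] by simp
  obtain y where y: "y \<in> Z" "z \<otimes> y = \<one>"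
    using central_subgroup_inverse[OF z] by blast
  \<comment> \<open>With y the inverse of z, w = z(yw), so the representative of aw in the coset of
    za is yw.\<close>
  have "a \<otimes> w \<in> (z \<otimes> a) <# Z" if w: "w \<in> Z" for w
  proof -
    have "z \<otimes> (y \<otimes> w) = w"
      using center_assoc(1)[OF zc, of y w] y w
      by (simp add: central_subgroup_center center_closed loop_unit)
    then have "(z \<otimes> a) \<otimes> (y \<otimes> w) = a \<otimes> w"
      using eq[OF central_subgroup_mult[OF y(1) w]] by simp
    then show ?thesis
      using central_subgroup_mult[OF y(1) w] by (force simp: l_coset_def)
  qed
  moreover have "(z \<otimes> a) \<otimes> w \<in> a <# Z" if "w \<in> Z" for w
    using central_subgroup_mult[OF z that] eq[OF that] by (auto simp: l_coset_def)
  ultimately show ?thesis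
    by (auto simp: l_coset_def)
qed

text \<open>The unit of \<open>LMod\<close> is the subgroup itself; writing it as the coset of 1
  lets \<open>l_coset_mult\<close> compute products with it.\<close>

lemma l_coset_one: "\<one> <# Z = Z"
proof -
  have "\<one> \<otimes> z = z" if "z \<in> Z" for z
    using loop_unit[OF center_closed[OF central_subgroup_center[OF that]]] by blast
  then show ?thesis
    by (simp add: l_coset_def)
qed

end

end

theorem theorem2p4:
  fixes G :: "('a, 'b) monoid_scheme" and Z\<^sub>0 :: "'a set"
  assumes "metagroup G"
    and "subgroup Z\<^sub>0 (G\<lparr>carrier := loop_center G\<rparr>)"
    and "\<And>a b c. \<lbrakk>a \<in> carrier G; b \<in> carrier G; c \<in> carrier G\<rbrakk> \<Longrightarrow> loop_t G a b c \<in> Z\<^sub>0"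
  shows "group (G LMod Z\<^sub>0)"
proof -
  interpret metagroup G by fact
  note mult = l_coset_mult[OF assms(2)] and one = l_coset_one[OF assms(2)]
  have carrier: "carrier (G LMod Z\<^sub>0) = (\<lambda>a. a <#\<^bsub>G\<^esub> Z\<^sub>0) ` carrier G"
    by (auto simp: LFactGroup_def LCOSETS_def)
  have carrierI: "a <#\<^bsub>G\<^esub> Z\<^sub>0 \<in> carrier (G LMod Z\<^sub>0)" if "a \<in> carrier G" for a
    unfolding carrier using that by (rule imageI)
  have ops: "X \<otimes>\<^bsub>G LMod Z\<^sub>0\<^esub> Y = X <#>\<^bsub>G\<^esub> Y" "\<one>\<^bsub>G LMod Z\<^sub>0\<^esub> = \<one>\<^bsub>G\<^esub> <#\<^bsub>G\<^esub> Z\<^sub>0" for X Y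
    by (simp_all add: LFactGroup_def one)
  show ?thesis
  proof (rule groupI)
    show "\<one>\<^bsub>G LMod Z\<^sub>0\<^esub> \<in> carrier (G LMod Z\<^sub>0)"
      unfolding ops by (rule carrierI[OF loop_unit_closed])
  next
    fix X Y assume "X \<in> carrier (G LMod Z\<^sub>0)" "Y \<in> carrier (G LMod Z\<^sub>0)"
    then obtain a b where "a \<in> carrier G" "X = a <#\<^bsub>G\<^esub> Z\<^sub>0" "b \<in> carrier G" "Y = b <#\<^bsub>G\<^esub> Z\<^sub>0"
      unfolding carrier by (elim imageE)
    then show "X \<otimes>\<^bsub>G LMod Z\<^sub>0\<^esub> Y \<in> carrier (G LMod Z\<^sub>0)"
      by (simp add: ops mult carrierI loop_mult_closed)
  next
    fix X Y W
    assume "X \<in> carrier (G LMod Z\<^sub>0)" "Y \<in> carrier (G LMod Z\<^sub>0)" "W \<in> carrier (G LMod Z\<^sub>0)"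
    then obtain a b c where abc: "a \<in> carrier G" "b \<in> carrier G" "c \<in> carrier G"
      and eqs: "X = a <#\<^bsub>G\<^esub> Z\<^sub>0" "Y = b <#\<^bsub>G\<^esub> Z\<^sub>0" "W = c <#\<^bsub>G\<^esub> Z\<^sub>0"
      unfolding carrier by (elim imageE)
    \<comment> \<open>\<open>metagroup_assoc\<close> turns (ab)c into t(a(bc)) with t in
      \<open>Z\<^sub>0\<close>, and the coset of a(bc) absorbs t. Thus associativity, which may fail
      in \<open>G\<close>, holds for cosets.\<close>
    have "(a \<otimes>\<^bsub>G\<^esub> b) \<otimes>\<^bsub>G\<^esub> c <#\<^bsub>G\<^esub> Z\<^sub>0 = a \<otimes>\<^bsub>G\<^esub> (b \<otimes>\<^bsub>G\<^esub> c) <#\<^bsub>G\<^esub> Z\<^sub>0"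
      unfolding metagroup_assoc[OF abc]
      using abc by (intro l_coset_absorb[OF assms(2) assms(3)] loop_mult_closed)
    then show "X \<otimes>\<^bsub>G LMod Z\<^sub>0\<^esub> Y \<otimes>\<^bsub>G LMod Z\<^sub>0\<^esub> W = X \<otimes>\<^bsub>G LMod Z\<^sub>0\<^esub> (Y \<otimes>\<^bsub>G LMod Z\<^sub>0\<^esub> W)"
      using abc by (simp add: eqs ops mult loop_mult_closed)
  next
    fix X assume "X \<in> carrier (G LMod Z\<^sub>0)"
    then obtain a where a: "a \<in> carrier G" "X = a <#\<^bsub>G\<^esub> Z\<^sub>0"
      unfolding carrier by (elim imageE)
    then show "\<one>\<^bsub>G LMod Z\<^sub>0\<^esub> \<otimes>\<^bsub>G LMod Z\<^sub>0\<^esub> X = X"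
      by (simp add: ops mult loop_unit_closed loop_unit)
    \<comment> \<open>In \<open>G\<close> the left and right inverses of a may differ;
      \<open>groupI\<close> asks for a left one, so y = 1/a is taken from right division.\<close>
    obtain y where "y \<in> carrier G" "y \<otimes>\<^bsub>G\<^esub> a = \<one>\<^bsub>G\<^esub>"
      using ex1_implies_ex[OF loop_right_div[OF a(1) loop_unit_closed]] by blast
    then show "\<exists>Y\<in>carrier (G LMod Z\<^sub>0). Y \<otimes>\<^bsub>G LMod Z\<^sub>0\<^esub> X = \<one>\<^bsub>G LMod Z\<^sub>0\<^esub>"
      using a by (intro bexI[OF _ carrierI[of y]]) (simp_all add: ops mult)
  qed
qed

end
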